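(* Let $n\ge 1$, let $p=(p_1,\ldots,p_n)\in[0,1]^n$, and let $q=1-p$, i.e. $q_i=1-p_i$ for every $i\in\{1,\ldots,n\}$. Then $$\|\mathrm{Ber}(p)-\mathrm{Ber}(q)\|_{\mathrm{TV}}\ \le\ \|p-q\|_2.$$
   Context: For two probability distributions $P,Q$ on a finite set $\Omega$, the total variation distance is $\|P-Q\|_{\mathrm{TV}}=\frac12\sum_{\omega\in\Omega}|P(\omega)-Q(\omega)|$. For $p\in[0,1]$, $\mathrm{Ber}(p)$ is the Bernoulli measure on $\{0,1\}$ with $\mathrm{Ber}(p)(1)=p$ and $\mathrm{Ber}(p)(0)=1-p$. For $p=(p_1,\ldots,p_n)\in[0,1]^n$, $\mathrm{Ber}(p)=\mathrm{Ber}(p_1)\otimes\cdots\otimes\mathrm{Ber}(p_n)$ is the product measure on $\{0,1\}^n$. For $x\in\mathbb{R}^n$, $\|x\|_2=(\sum_{i=1}^n x_i^2)^{1/2}$. *)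

theory Defs
  imports "HOL-Probability.Probability" "HOL-Probability.Product_PMF"
begin

definition tv_dist :: "'a::finite pmf \<Rightarrow> 'a pmf \<Rightarrow> real" where
  "tv_dist P Q = (1/2) * (\<Sum>\<omega>\<in>UNIV. \<bar>pmf P \<omega> - pmf Q \<omega>\<bar>)"

(* The set {0,1}^n is the finite type 'n => bool, with True for 1 and False for 0.
   The second argument of Pi_pmf is the value taken outside the index set; it plays
   no role here, as the index set is UNIV. bernoulli_pmf clamps its parameter to [0,1],
   so Ber p is the intended measure only when all entries of p lie in [0,1]. *)
definition Ber :: "real ^ 'n \<Rightarrow> ('n::finite \<Rightarrow> bool) pmf" where
  "Ber p = Pi_pmf UNIV False (\<lambda>i. bernoulli_pmf (p $ i))"

end

theory Submission
  imports Defs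
begin

text \<open>
  By Cauchy--Schwarz, the total variation distance is at most the square root of
  \<open>1 - BC\<^sup>2\<close>, where \<open>BC\<close> is the Bhattacharyya coefficient of the two distributions. This
  coefficient is multiplicative over products, and for the pair \<open>Ber(p)\<close>, \<open>Ber(1 - p)\<close> in one
  dimension it is \<open>sqrt (1 - (2 p - 1)\<^sup>2)\<close>. The bound
  \<open>1 - \<Prod> (1 - x\<^sub>i) \<le> \<Sum> x\<^sub>i\<close> with \<open>x\<^sub>i = (2 p\<^sub>i - 1)\<^sup>2 = (p\<^sub>i - q\<^sub>i)\<^sup>2\<close> concludes.
\<close>

definition bhattacharyya :: "'a::finite pmf \<Rightarrow> 'a pmf \<Rightarrow> real" where
  "bhattacharyya P Q = (\<Sum>\<omega>\<in>UNIV. sqrt (pmf P \<omega> * pmf Q \<omega>))"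

text \<open>Factor \<open>a - b = (sqrt a - sqrt b) * (sqrt a + sqrt b)\<close> before applying
  Cauchy-Schwarz: since both masses are 1, the two sums of squares are \<open>2 - 2 * BC\<close> and
  \<open>2 + 2 * BC\<close>.\<close>

lemma tv_dist_sq_le:
  "(tv_dist P Q)\<^sup>2 \<le> 1 - (bhattacharyya P Q)\<^sup>2"
proof -
  let ?f = "\<lambda>\<omega>. \<bar>sqrt (pmf P \<omega>) - sqrt (pmf Q \<omega>)\<bar>"
  let ?g = "\<lambda>\<omega>. sqrt (pmf P \<omega>) + sqrt (pmf Q \<omega>)"
  let ?B = "bhattacharyya P Q"
  have one: "(\<Sum>\<omega>\<in>UNIV. pmf R \<omega>) = 1" for R :: "'a pmf"
    by (rule sum_pmf_eq_1) auto
  have "\<bar>pmf P \<omega> - pmf Q \<omega>\<bar> = ?f \<omega> * ?g \<omega>" for \<omega>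
  proof -
    have "?f \<omega> * ?g \<omega> = \<bar>(sqrt (pmf P \<omega>) - sqrt (pmf Q \<omega>)) * ?g \<omega>\<bar>"
      by (simp add: abs_mult)
    then show ?thesis by (simp add: algebra_simps)
  qed
  then have "(tv_dist P Q)\<^sup>2 = 1/4 * (\<Sum>\<omega>\<in>UNIV. ?f \<omega> * ?g \<omega>)\<^sup>2"
    by (simp add: tv_dist_def power2_eq_square)
  also have "\<dots> \<le> 1/4 * ((\<Sum>\<omega>\<in>UNIV. (?f \<omega>)\<^sup>2) * (\<Sum>\<omega>\<in>UNIV. (?g \<omega>)\<^sup>2))"
    using Cauchy_Schwarz_ineq_sum[of ?f ?g UNIV] by simp
  also have "(\<Sum>\<omega>\<in>UNIV. (?f \<omega>)\<^sup>2) = 2 - 2 * ?B"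
    by (simp add: bhattacharyya_def power2_diff real_sqrt_mult sum.distrib sum_subtractf
        sum_distrib_left one mult.assoc)
  also have "(\<Sum>\<omega>\<in>UNIV. (?g \<omega>)\<^sup>2) = 2 + 2 * ?B"
    by (simp add: bhattacharyya_def power2_sum real_sqrt_mult sum.distrib
        sum_distrib_left one mult.assoc)
  also have "1/4 * ((2 - 2 * ?B) * (2 + 2 * ?B)) = 1 - ?B\<^sup>2"
    by (simp add: algebra_simps power2_eq_square)
  finally show ?thesis .
qed

lemma real_sqrt_prod: "sqrt (\<Prod>i\<in>A. f i) = (\<Prod>i\<in>A. sqrt (f i))"
  by (induction A rule: infinite_finite_induct) (auto simp: real_sqrt_mult)

text \<open>Distributivity expands the product of sums over single outcomes into one sum over all
  functions.\<close>

lemma bhattacharyya_Pi_pmf: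
  fixes P Q :: "'i::finite \<Rightarrow> 'b::finite pmf"
  shows "bhattacharyya (Pi_pmf UNIV d P) (Pi_pmf UNIV d Q) = (\<Prod>i\<in>UNIV. bhattacharyya (P i) (Q i))"
proof -
  have "(\<Prod>i\<in>UNIV. \<Sum>b\<in>UNIV. sqrt (pmf (P i) b * pmf (Q i) b)) =
      (\<Sum>\<omega>\<in>UNIV. \<Prod>i\<in>UNIV. sqrt (pmf (P i) (\<omega> i) * pmf (Q i) (\<omega> i)))"
    by (subst prod_sum_PiE) (auto simp: PiE_UNIV_domain)
  moreover have "sqrt (pmf (Pi_pmf UNIV d P) \<omega> * pmf (Pi_pmf UNIV d Q) \<omega>) =
      (\<Prod>i\<in>UNIV. sqrt (pmf (P i) (\<omega> i) * pmf (Q i) (\<omega> i)))" for \<omega>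
    by (simp add: pmf_Pi real_sqrt_prod flip: prod.distrib)
  ultimately show ?thesis
    by (simp add: bhattacharyya_def)
qed

text \<open>Both outcomes contribute \<open>sqrt (p * (1 - p))\<close>, so the square is
  \<open>4 * p * (1 - p)\<close>.\<close>

lemma bhattacharyya_bernoulli_flip_sq:
  assumes "p \<in> {0..1}"
  shows "(bhattacharyya (bernoulli_pmf p) (bernoulli_pmf (1 - p)))\<^sup>2 = 1 - (p - (1 - p))\<^sup>2"
  using assms
  by (simp add: bhattacharyya_def UNIV_bool mult.commute) (simp add: power2_eq_square algebra_simps)

theorem theorem3:
  fixes p q :: "real ^ 'n"
  assumes "\<And>i. p $ i \<in> {0..1}"
    and "\<And>i. q $ i = 1 - p $ i"
  shows "tv_dist (Ber p) (Ber q) \<le> norm (p - q)"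
proof (rule power2_le_imp_le)
  let ?x = "\<lambda>i. (p $ i - q $ i)\<^sup>2"
  \<comment> \<open>The difference \<open>2 * p $ i - 1\<close> lies in [-1, 1]; the Weierstrass
    product inequality below needs its square in [0, 1].\<close>
  have x: "?x i \<in> {0..1}" for i
    using assms(1)[of i] by (auto simp: assms(2) abs_square_le_1)
  have "(bhattacharyya (Ber p) (Ber q))\<^sup>2 = (\<Prod>i\<in>UNIV. 1 - ?x i)"
    unfolding Ber_def bhattacharyya_Pi_pmf prod_power_distrib[symmetric]
    using bhattacharyya_bernoulli_flip_sq assms by (simp add: prod_power_distrib)
  then have "(tv_dist (Ber p) (Ber q))\<^sup>2 \<le> 1 - (\<Prod>i\<in>UNIV. 1 - ?x i)"
    using tv_dist_sq_le[of "Ber p" "Ber q"] by simp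
  also have "\<dots> \<le> (\<Sum>i\<in>UNIV. ?x i)"
    using Weierstrass_prod_ineq[of UNIV ?x] x by simp
  also have "\<dots> = (norm (p - q))\<^sup>2"
    by (simp add: norm_vec_def L2_set_def sum_nonneg)
  finally show "(tv_dist (Ber p) (Ber q))\<^sup>2 \<le> (norm (p - q))\<^sup>2" .
qed simp

end
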